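(* Let $p$ be a prime, $t$ a positive integer with $t<\sqrt p$, and let $A\subseteq\mathbb{F}_p$ be a non-averaging set of order $t$. Then $|A|\ll p/t^{2/3}$, with an absolute implied constant.
   Context: A set $A\subseteq\mathbb{F}_p$ is non-averaging of order $t$ if for all integers $1\le m,n\le t$, the equation $mX_1+nX_2=(m+n)X_3$ has no solutions $(X_1,X_2,X_3)\in A^3$ in $\mathbb{F}_p$ other than the trivial ones $X_1=X_2=X_3$. *)

theory Defs
  imports Complex_Main "HOL-Number_Theory.Number_Theory"
begin

text \<open>
  The field with \<open>p\<close> elements is the library's \<^const>\<open>residue_ring\<close>, whose carrier is
  \<open>{0..p - 1}\<close>. Its elements are thus canonical representatives, so equality in the field is
  equality of integers, while equations with integer coefficients are congruences modulo \<open>p\<close>.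
\<close>

definition non_averaging :: "nat \<Rightarrow> nat \<Rightarrow> int set \<Rightarrow> bool" where
  "non_averaging p t A \<longleftrightarrow>
     A \<subseteq> carrier (residue_ring (int p)) \<and>
     (\<forall>m n :: int. 1 \<le> m \<and> m \<le> int t \<and> 1 \<le> n \<and> n \<le> int t \<longrightarrow>
        (\<forall>x1\<in>A. \<forall>x2\<in>A. \<forall>x3\<in>A.
           [m * x1 + n * x2 = (m + n) * x3] (mod int p) \<longrightarrow> x1 = x2 \<and> x2 = x3))"

end

theory Submission imports Defs begin

text \<open>
  With \<open>F k = (\<Sum>x\<in>A. e(k x / p))\<close> and \<open>Q\<close> the set of ratios \<open>m / n\<close> in the field, the absence of
  nontrivial solutions says \<open>p |A| = (\<Sum>k. F (q k) F k (F ((q + 1) k))\<^sup>*)\<close> for every \<open>q \<in> Q\<close>. The term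
  \<open>k = 0\<close> is \<open>|A|\<^sup>3\<close>, so the other frequencies have total absolute value at least
  \<open>|Q| (|A|\<^sup>3 - p |A|)\<close> over all \<open>q \<in> Q\<close>. On the other hand \<open>|F k| \<le> (\<delta> + |F k|\<^sup>2 / \<delta>) / 2\<close>: in the
  first part Parseval's identity is applied for fixed \<open>q\<close> to the sum over \<open>k\<close>, in the second part
  for fixed \<open>k\<close> to the sum over \<open>q\<close>, where \<open>q \<mapsto> q k\<close> is injective. With \<open>\<delta> = |A|\<^sup>2 / (2 p)\<close> this
  gives \<open>|Q| |A|\<^sup>3 \<le> 4 p\<^sup>3\<close> unless \<open>|A|\<^sup>2 < 2 p\<close>. Since \<open>t\<^sup>2 < p\<close>, distinct fractions in lowest terms
  give distinct elements of \<open>Q\<close>, so \<open>|Q| \<ge> t\<^sup>2 / 4\<close>.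
\<close>

section \<open>Additive characters\<close>

text \<open>The standard additive character of the integers modulo \<open>p\<close>. Its argument is
  an arbitrary integer, so products such as \<open>k * x\<close> need no reduction.\<close>

definition add_char :: "nat \<Rightarrow> int \<Rightarrow> complex" where
  "add_char p k = cis (2 * pi * of_int k / of_nat p)"

lemma add_char_0 [simp]: "add_char p 0 = 1"
  by (simp add: add_char_def)

lemma add_char_add: "add_char p (j + k) = add_char p j * add_char p k"
  by (simp add: add_char_def cis_mult add_divide_distrib distrib_left)

lemma add_char_minus: "add_char p (- k) = cnj (add_char p k)"
  by (simp add: add_char_def cis_cnj)

lemma add_char_mult_nat: "add_char p (int n * k) = add_char p k ^ n"
  by (simp add: add_char_def DeMoivre mult_ac)

lemma add_char_eq_1_iff:
  assumes "p > 0"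
  shows "add_char p k = 1 \<longleftrightarrow> int p dvd k"
proof
  assume "add_char p k = 1"
  then have "cos (2 * pi * of_int k / of_nat p) = 1"
    by (simp add: add_char_def complex_eq_iff)
  then obtain n :: int where "2 * pi * of_int k / of_nat p = of_int n * 2 * pi"
    by (auto simp: cos_one_2pi_int)
  then have "of_int k = (of_int (n * int p) :: real)"
    using assms by (simp add: field_simps)
  then show "int p dvd k"
    by (metis dvd_triv_right of_int_eq_iff)
next
  assume "int p dvd k"
  then obtain c where "k = int p * c" ..
  then have "2 * pi * of_int k / of_nat p = 2 * pi * (of_int c :: real)"
    using assms by simp
  then show "add_char p k = 1"
    by (simp add: add_char_def cis_multiple_2pi)
qed

lemma add_char_mod:
  assumes "p > 0"
  shows "add_char p (k mod int p) = add_char p k"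
proof -
  have "add_char p k = add_char p (int p * (k div int p)) * add_char p (k mod int p)"
    by (simp flip: add_char_add)
  also have "add_char p (int p * (k div int p)) = 1"
    using assms by (simp add: add_char_eq_1_iff)
  finally show ?thesis by simp
qed

text \<open>Orthogonality: the sum is geometric with ratio \<open>add_char p y\<close>, a
  \<open>p\<close>-th root of unity that equals 1 exactly when \<open>p\<close> divides
  \<open>y\<close>.\<close>

lemma sum_add_char:
  assumes "p > 0"
  shows "(\<Sum>k\<in>{0..<int p}. add_char p (k * y)) = (if int p dvd y then of_nat p else 0)"
proof -
  have "(\<Sum>k\<in>{0..<int p}. add_char p (k * y)) = (\<Sum>n<p. add_char p y ^ n)"
    by (rule sum.reindex_bij_witness[of _ int nat]) (auto simp flip: add_char_mult_nat)
  moreover have "add_char p y ^ p = 1"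
    using assms by (simp add: add_char_eq_1_iff flip: add_char_mult_nat)
  ultimately show ?thesis
    using add_char_eq_1_iff[OF assms, of y]
    by (cases "add_char p y = 1") (simp_all add: geometric_sum)
qed

text \<open>Orthogonality as a counting device, with a general index set so that it serves both the
  pairs in Parseval's identity and the triples in the three-variable equation.\<close>

lemma sum_add_char_count:
  assumes "p > 0" "finite I"
  shows "(\<Sum>k\<in>{0..<int p}. \<Sum>i\<in>I. add_char p (k * h i)) = of_nat (p * card {i\<in>I. int p dvd h i})"
proof -
  have "(\<Sum>k\<in>{0..<int p}. \<Sum>i\<in>I. add_char p (k * h i)) =
    (\<Sum>i\<in>I. if int p dvd h i then of_nat p else 0)"
    by (subst sum.swap) (simp add: sum_add_char[OF assms(1)])
  also have "\<dots> = of_nat (p * card {i\<in>I. int p dvd h i})"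
    using assms(2) by (simp flip: sum.inter_filter)
  finally show ?thesis .
qed

section \<open>Fourier transforms of sets of residues\<close>

definition set_fourier :: "nat \<Rightarrow> int set \<Rightarrow> int \<Rightarrow> complex" where
  "set_fourier p A k = (\<Sum>x\<in>A. add_char p (k * x))"

lemma set_fourier_0: "set_fourier p A 0 = of_nat (card A)"
  by (simp add: set_fourier_def)

lemma set_fourier_mod:
  assumes "p > 0"
  shows "set_fourier p A (k mod int p) = set_fourier p A k"
  unfolding set_fourier_def
proof (rule sum.cong)
  fix x
  show "add_char p (k mod int p * x) = add_char p (k * x)"
    by (metis add_char_mod[OF assms] mod_mult_left_eq)
qed simp

lemma cnj_set_fourier: "cnj (set_fourier p A k) = (\<Sum>x\<in>A. add_char p (- (k * x)))"
  by (simp add: set_fourier_def add_char_minus)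

text \<open>The squared modulus expands into characters of differences of elements of
  \<open>A\<close>, and orthogonality keeps only the pairs congruent modulo
  \<open>p\<close>.\<close>

lemma parseval_set_fourier:
  assumes "p > 0" "A \<subseteq> {0..<int p}"
  shows "(\<Sum>k\<in>{0..<int p}. (cmod (set_fourier p A k))\<^sup>2) = real (p * card A)"
proof -
  have fin: "finite A"
    using assms(2) finite_subset by blast
  have "set_fourier p A k * cnj (set_fourier p A k) =
      (\<Sum>i\<in>A \<times> A. add_char p (k * (fst i - snd i)))" for k
    unfolding cnj_set_fourier unfolding set_fourier_def sum_product
    by (simp add: sum.cartesian_product case_prod_beta right_diff_distrib flip: add_char_add)
  then have "complex_of_real (\<Sum>k\<in>{0..<int p}. (cmod (set_fourier p A k))\<^sup>2) =
      (\<Sum>k\<in>{0..<int p}. \<Sum>i\<in>A \<times> A. add_char p (k * (fst i - snd i)))"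
    by (simp only: of_real_sum complex_norm_square)
  also have "\<dots> = of_nat (p * card {i\<in>A \<times> A. int p dvd fst i - snd i})"
    using assms(1) fin by (intro sum_add_char_count) auto
  \<comment> \<open>The elements of \<open>A\<close> are reduced representatives, so congruent ones
    are equal and only the diagonal remains.\<close>
  also have "{i\<in>A \<times> A. int p dvd fst i - snd i} = (\<lambda>x. (x, x)) ` A"
  proof -
    have "x = y" if "x \<in> A" "y \<in> A" "int p dvd x - y" for x y
      using that assms(2) by (metis atLeastLessThan_iff mod_eq_dvd_iff mod_pos_pos_trivial subsetD)
    then show ?thesis by fastforce
  qed
  also have "card \<dots> = card A"
    by (intro card_image) (auto simp: inj_on_def)
  finally show ?thesis
    by (metis of_real_eq_iff of_real_of_nat_eq)
qed

text \<open>By periodicity and injectivity the left side is a sum over distinct reduced frequencies;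
  the missing ones can be added because \<open>g\<close> is nonnegative.\<close>

lemma sum_le_of_inj_mod:
  fixes g :: "int \<Rightarrow> real"
  assumes "p > 0" and "\<And>k. g (k mod int p) = g k" and "\<And>k. g k \<ge> 0"
    and "inj_on (\<lambda>i. h i mod int p) I"
  shows "(\<Sum>i\<in>I. g (h i)) \<le> (\<Sum>k\<in>{0..<int p}. g k)"
proof -
  have "(\<Sum>i\<in>I. g (h i)) = (\<Sum>i\<in>I. g (h i mod int p))"
    by (simp add: assms(2))
  also have "\<dots> = (\<Sum>k\<in>(\<lambda>i. h i mod int p) ` I. g k)"
    by (simp add: sum.reindex[OF assms(4)])
  also have "\<dots> \<le> (\<Sum>k\<in>{0..<int p}. g k)"
    using assms(1,3) by (intro sum_mono2) auto
  finally show ?thesis .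
qed

text \<open>Split the product by 2xy \<le> x^2 + y^2 and apply Parseval to each square. The index
  \<open>i\<close> is left abstract because it stands once for a frequency and once for a
  ratio.\<close>

lemma sum_set_fourier_mult_le:
  assumes "p > 0" "A \<subseteq> {0..<int p}"
    and "inj_on (\<lambda>i. h i mod int p) I" "inj_on (\<lambda>i. h' i mod int p) I"
  shows "(\<Sum>i\<in>I. cmod (set_fourier p A (h i)) * cmod (set_fourier p A (h' i))) \<le> real (p * card A)"
proof -
  have le: "(\<Sum>i\<in>I. (cmod (set_fourier p A (f i)))\<^sup>2) \<le> real (p * card A)"
    if "inj_on (\<lambda>i. f i mod int p) I" for f
    unfolding parseval_set_fourier[OF assms(1,2), symmetric]
    using assms(1) that by (intro sum_le_of_inj_mod) (auto simp: set_fourier_mod)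
  have "(\<Sum>i\<in>I. cmod (set_fourier p A (h i)) * cmod (set_fourier p A (h' i))) \<le>
      (\<Sum>i\<in>I. ((cmod (set_fourier p A (h i)))\<^sup>2 + (cmod (set_fourier p A (h' i)))\<^sup>2) / 2)"
  proof (rule sum_mono)
    fix i
    show "cmod (set_fourier p A (h i)) * cmod (set_fourier p A (h' i)) \<le>
        ((cmod (set_fourier p A (h i)))\<^sup>2 + (cmod (set_fourier p A (h' i)))\<^sup>2) / 2"
      using sum_squares_bound[of "cmod (set_fourier p A (h i))" "cmod (set_fourier p A (h' i))"]
      by simp
  qed
  also have "\<dots> \<le> real (p * card A)"
    using le[OF assms(3)] le[OF assms(4)]
    by (simp add: sum.distrib flip: sum_divide_distrib)
  finally show ?thesis .
qed

section \<open>Sets without nontrivial solutions\<close>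

text \<open>Expanding the product gives characters of q x1 + x2 - (q + 1) x3, so the sum is
  \<open>p\<close> times the number of solutions in \<open>A\<close>. The diagonal triples always
  solve the equation, and by \<open>triv\<close> nothing else does.\<close>

lemma sum_set_fourier_trivial_solutions:
  assumes "p > 0" "finite A"
    and triv: "\<And>x1 x2 x3. \<lbrakk>x1 \<in> A; x2 \<in> A; x3 \<in> A; [q * x1 + x2 = (q + 1) * x3] (mod int p)\<rbrakk>
      \<Longrightarrow> x1 = x2 \<and> x2 = x3"
  shows "(\<Sum>k\<in>{0..<int p}. set_fourier p A (q * k) * set_fourier p A k *
      cnj (set_fourier p A ((q + 1) * k))) = of_nat (p * card A)"
proof -
  let ?h = "\<lambda>(x1, x2, x3). q * x1 + x2 - (q + 1) * x3"
  have "set_fourier p A (q * k) * set_fourier p A k * cnj (set_fourier p A ((q + 1) * k)) =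
    (\<Sum>i\<in>A \<times> A \<times> A. add_char p (k * ?h i))" for k
  proof -
    have "add_char p (k * ?h (x1, x2, x3)) =
        add_char p (q * k * x1) * (add_char p (k * x2) * add_char p (- ((q + 1) * k * x3)))"
      for x1 x2 x3
      unfolding add_char_add[symmetric] by (simp add: algebra_simps)
    then have "(\<Sum>i\<in>A \<times> A \<times> A. add_char p (k * ?h i)) = (\<Sum>x1\<in>A. \<Sum>x2\<in>A. \<Sum>x3\<in>A.
        add_char p (q * k * x1) * (add_char p (k * x2) * add_char p (- ((q + 1) * k * x3))))"
      by (simp only: sum.cartesian_product split_def fst_conv snd_conv)
    also have "\<dots> = set_fourier p A (q * k) *
        (set_fourier p A k * cnj (set_fourier p A ((q + 1) * k)))"
      unfolding cnj_set_fourier unfolding set_fourier_def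
      by (simp only: flip: sum_distrib_left sum_distrib_right)
    finally show ?thesis
      by (simp only: mult.assoc)
  qed
  then have "(\<Sum>k\<in>{0..<int p}. set_fourier p A (q * k) * set_fourier p A k *
      cnj (set_fourier p A ((q + 1) * k))) =
    (\<Sum>k\<in>{0..<int p}. \<Sum>i\<in>A \<times> A \<times> A. add_char p (k * ?h i))"
    by (intro sum.cong refl)
  also have "\<dots> = of_nat (p * card {i\<in>A \<times> A \<times> A. int p dvd ?h i})"
    using assms by (intro sum_add_char_count) auto
  also have "{i\<in>A \<times> A \<times> A. int p dvd ?h i} = (\<lambda>x. (x, x, x)) ` A"
    using triv by (auto simp: cong_iff_dvd_diff algebra_simps)
  also have "card \<dots> = card A"
    by (intro card_image) (auto simp: inj_on_def)
  finally show ?thesis .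
qed

lemma inj_on_mult_mod_prime:
  assumes "prime p" "\<not> int p dvd c"
  shows "inj_on (\<lambda>k. c * k mod int p) {0..<int p}"
proof (rule inj_onI)
  fix j k
  assume jk: "j \<in> {0..<int p}" "k \<in> {0..<int p}" "c * j mod int p = c * k mod int p"
  have "coprime c (int p)"
    using assms by (metis coprime_commute prime_imp_coprime prime_nat_int_transfer)
  with jk(3) have "[j = k] (mod int p)"
    by (metis cong_def cong_mult_lcancel)
  with jk(1,2) show "j = k"
    by (simp add: cong_def)
qed

text \<open>Keeping the residues 0 and -1 out of \<open>Q\<close> makes both \<open>q\<close> and
  \<open>q + 1\<close> invertible, so that multiplication by either one permutes the frequencies.
  The assumption \<open>large\<close> keeps the contribution of the trivial solutions below half of
  the main term.\<close>

lemma card_pow3_le_of_trivial_solutions: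
  assumes p: "prime p" and A: "A \<subseteq> {0..<int p}" and Q: "Q \<subseteq> {1..<int p - 1}"
    and triv: "\<And>q x1 x2 x3. \<lbrakk>q \<in> Q; x1 \<in> A; x2 \<in> A; x3 \<in> A;
      [q * x1 + x2 = (q + 1) * x3] (mod int p)\<rbrakk> \<Longrightarrow> x1 = x2 \<and> x2 = x3"
    and large: "2 * p \<le> (card A)\<^sup>2"
  shows "real (card Q) * real (card A) ^ 3 \<le> 4 * real p ^ 3"
proof -
  define a where "a = real (card A)"
  define f where "f k = cmod (set_fourier p A k)" for k
  define T where "T = (\<Sum>q\<in>Q. \<Sum>k\<in>{1..<int p}. f k * (f (q * k) * f ((q + 1) * k)))"
  \<comment> \<open>Chosen so that \<open>\<delta> * (real p * a)\<close> is
    \<open>a ^ 3 / 2\<close>: after the averaging factor 1/2, the first part of the upper bound is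
    half of the lower bound and can be absorbed.\<close>
  define \<delta> where "\<delta> = a\<^sup>2 / (2 * real p)"
  have p0: "p > 0"
    using p prime_gt_0_nat by blast
  have fin: "finite A"
    using A finite_subset by blast
  have large': "2 * real p \<le> a\<^sup>2"
    using large unfolding a_def by (metis of_nat_le_iff of_nat_mult of_nat_numeral of_nat_power)
  then have a0: "a > 0"
    using p0 by (cases "a = 0") (auto simp: a_def)
  have \<delta>0: "\<delta> > 0"
    using a0 p0 by (simp add: \<delta>_def)
  have insert0: "{0..<int p} = insert 0 {1..<int p}"
    using p0 by auto
  have inj_k: "inj_on (\<lambda>k. c * k mod int p) {1..<int p}" if "c \<in> {1..<int p}" for c
    using that by (intro inj_on_subset[OF inj_on_mult_mod_prime[OF p]]) (auto dest: zdvd_imp_le)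
  \<comment> \<open>Both \<open>q\<close> and \<open>q + 1\<close> lie in
    \<open>{1..<int p}\<close>, where multiplication by \<open>k\<close> is injective modulo
    \<open>p\<close>.\<close>
  have inj_q: "inj_on (\<lambda>q. (q + c) * k mod int p) Q" if "k \<in> {1..<int p}" "c \<in> {0, 1}" for c k
  proof -
    have "inj_on ((\<lambda>q. k * q mod int p) \<circ> (\<lambda>q. q + c)) Q"
    proof (rule comp_inj_on)
      show "inj_on (\<lambda>q. k * q mod int p) ((\<lambda>q. q + c) ` Q)"
        using inj_k[OF that(1)] by (rule inj_on_subset) (use Q that(2) in auto)
    qed (simp add: inj_on_def)
    then show ?thesis
      by (simp add: o_def mult.commute)
  qed
  have lower: "a ^ 3 - real p * a \<le> (\<Sum>k\<in>{1..<int p}. f k * (f (q * k) * f ((q + 1) * k)))"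
    if "q \<in> Q" for q
  proof -
    let ?g = "\<lambda>k. set_fourier p A (q * k) * set_fourier p A k * cnj (set_fourier p A ((q + 1) * k))"
    have "(\<Sum>k\<in>{0..<int p}. ?g k) = of_nat (p * card A)"
      using sum_set_fourier_trivial_solutions[OF p0 fin triv[OF that]] .
    \<comment> \<open>The frequency 0 is split off as the main term.\<close>
    then have "of_nat (card A) ^ 3 + (\<Sum>k\<in>{1..<int p}. ?g k) = of_nat (p * card A)"
      unfolding insert0 by (simp add: set_fourier_0 power3_eq_cube)
    then have eq: "complex_of_real (a ^ 3 - real p * a) = - (\<Sum>k\<in>{1..<int p}. ?g k)"
      by (simp add: a_def eq_neg_iff_add_eq_0 algebra_simps)
    have "a ^ 3 - real p * a \<le> \<bar>a ^ 3 - real p * a\<bar>"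
      by (rule abs_ge_self)
    also have "\<dots> = cmod (\<Sum>k\<in>{1..<int p}. ?g k)"
      by (metis eq norm_minus_cancel norm_of_real)
    also have "\<dots> \<le> (\<Sum>k\<in>{1..<int p}. cmod (?g k))"
      by (rule norm_sum)
    also have "\<dots> = (\<Sum>k\<in>{1..<int p}. f k * (f (q * k) * f ((q + 1) * k)))"
      by (intro sum.cong refl) (simp only: norm_mult f_def complex_mod_cnj mult_ac)
    finally show ?thesis .
  qed
  have "real (card Q) * (a ^ 3 - real p * a) \<le> T"
    unfolding T_def using lower by (rule sum_bounded_below)
  moreover have "T \<le> (real (card Q) * a ^ 3 / 2 + 2 * real p ^ 3) / 2"
  proof -
    \<comment> \<open>This is 2xy \<le> x^2 + y^2 with y = \<delta>, divided by 2 \<delta>.\<close>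
    have f_le: "f k \<le> (\<delta> + (f k)\<^sup>2 / \<delta>) / 2" for k
      using sum_squares_bound[of "f k" \<delta>] \<delta>0
      by (simp add: field_simps power2_eq_square)
    have "T \<le> (\<Sum>q\<in>Q. \<Sum>k\<in>{1..<int p}.
        (\<delta> + (f k)\<^sup>2 / \<delta>) / 2 * (f (q * k) * f ((q + 1) * k)))"
      unfolding T_def by (intro sum_mono mult_right_mono f_le) (simp add: f_def)
    also have "\<dots> = (\<Sum>q\<in>Q. \<Sum>k\<in>{1..<int p}. (\<delta> * (f (q * k) * f ((q + 1) * k))
        + (f k)\<^sup>2 * (f (q * k) * f ((q + 1) * k)) / \<delta>) / 2)"
      by (intro sum.cong refl) (simp add: add_divide_distrib distrib_right)
    also have "\<dots> = (\<delta> * (\<Sum>q\<in>Q. \<Sum>k\<in>{1..<int p}. f (q * k) * f ((q + 1) * k))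
        + (\<Sum>q\<in>Q. \<Sum>k\<in>{1..<int p}. (f k)\<^sup>2 * (f (q * k) * f ((q + 1) * k))) / \<delta>) / 2"
      by (simp only: sum_distrib_left sum_divide_distrib add_divide_distrib sum.distrib)
    \<comment> \<open>In the second part the weight depends on \<open>k\<close> alone, so the sum
      over \<open>q\<close> is moved inside and bounded for each fixed nonzero
      \<open>k\<close>.\<close>
    also have "(\<Sum>q\<in>Q. \<Sum>k\<in>{1..<int p}. (f k)\<^sup>2 * (f (q * k) * f ((q + 1) * k))) =
        (\<Sum>k\<in>{1..<int p}. (f k)\<^sup>2 * (\<Sum>q\<in>Q. f (q * k) * f ((q + 1) * k)))"
      by (subst sum.swap) (simp add: sum_distrib_left)
    also have "\<dots> \<le> (\<Sum>k\<in>{1..<int p}. (f k)\<^sup>2 * (real p * a))"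
    proof (intro sum_mono mult_left_mono)
      fix k assume "k \<in> {1..<int p}"
      with inj_q[of k 0] inj_q[of k 1]
      show "(\<Sum>q\<in>Q. f (q * k) * f ((q + 1) * k)) \<le> real p * a"
        using sum_set_fourier_mult_le[OF p0 A, of "\<lambda>q. q * k" Q "\<lambda>q. (q + 1) * k"]
        by (simp add: f_def a_def)
    qed simp
    also have "\<dots> = (\<Sum>k\<in>{1..<int p}. (f k)\<^sup>2) * (real p * a)"
      by (simp add: sum_distrib_right)
    \<comment> \<open>The frequency 0 is put back so that Parseval applies to the outer sum as
      well.\<close>
    also have "\<dots> \<le> (\<Sum>k\<in>{0..<int p}. (f k)\<^sup>2) * (real p * a)"
      by (intro mult_right_mono sum_mono2) (use a0 in auto)
    also have "(\<Sum>k\<in>{0..<int p}. (f k)\<^sup>2) = real p * a"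
      using parseval_set_fourier[OF p0 A] by (simp add: f_def a_def)
    also have "(\<Sum>q\<in>Q. \<Sum>k\<in>{1..<int p}. f (q * k) * f ((q + 1) * k)) \<le> (\<Sum>q\<in>Q. real p * a)"
    proof (rule sum_mono)
      fix q assume "q \<in> Q"
      then have "q \<in> {1..<int p}" "q + 1 \<in> {1..<int p}"
        using Q by auto
      then show "(\<Sum>k\<in>{1..<int p}. f (q * k) * f ((q + 1) * k)) \<le> real p * a"
        using sum_set_fourier_mult_le[OF p0 A inj_k inj_k]
        by (simp add: f_def a_def)
    qed
    finally have "T \<le> (\<delta> * (real (card Q) * (real p * a)) + real p * a * (real p * a) / \<delta>) / 2"
      using \<delta>0 by (simp add: divide_right_mono)
    also have "\<dots> = (real (card Q) * a ^ 3 / 2 + 2 * real p ^ 3) / 2"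
      using a0 p0 by (simp add: \<delta>_def field_simps power2_eq_square power3_eq_cube)
    finally show ?thesis .
  qed
  moreover have "real (card Q) * (a ^ 3 / 2) \<le> real (card Q) * (a ^ 3 - real p * a)"
  proof (rule mult_left_mono)
    show "a ^ 3 / 2 \<le> a ^ 3 - real p * a"
      using mult_right_mono[OF large', of a] a0 by (simp add: power3_eq_cube power2_eq_square)
  qed simp
  \<comment> \<open>With \<open>N = card Q\<close>, the bounds combine to N a^3 / 2 \<le> N a^3 / 4
    + p^3.\<close>
  ultimately show ?thesis
    unfolding a_def by simp
qed

section \<open>Fractions in lowest terms\<close>

text \<open>Telescoping with 1/d^2 \<le> 1/(d - 1) - 1/d for d \<ge> 3. The term d = 2 is kept exact
  as 1/4 = 3/4 - 1/2, which brings the constant below 1.\<close>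

lemma sum_inverse_squares_le: "(\<Sum>d=2..t. 1 / (real d)\<^sup>2) \<le> 3 / 4"
proof (cases "t \<ge> 2")
  case True
  then have "(\<Sum>d=2..t. 1 / (real d)\<^sup>2) \<le> 3 / 4 - 1 / real t"
  proof (induction t rule: dec_induct)
    case (step n)
    have "1 / (real (Suc n))\<^sup>2 \<le> 1 / (real n * real (Suc n))"
      using step.hyps by (intro divide_left_mono) (auto simp: power2_eq_square)
    also have "\<dots> = 1 / real n - 1 / real (Suc n)"
      using step.hyps by (simp add: field_simps)
    finally show ?case
      using step by simp
  qed simp
  then show ?thesis
    by (smt (verit) divide_nonneg_nonneg of_nat_0_le_iff)
qed simp

lemma card_multiples_le:
  assumes "d > 0"
  shows "real (card {m\<in>{1..t}. d dvd m}) \<le> real t / real d"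
proof -
  have "{m\<in>{1..t}. d dvd m} \<subseteq> (*) d ` {1..t div d}"
  proof
    fix m assume "m \<in> {m\<in>{1..t}. d dvd m}"
    then obtain c where "m = d * c" "1 \<le> m" "m \<le> t" by auto
    with assms show "m \<in> (*) d ` {1..t div d}"
      by (auto simp: less_eq_div_iff_mult_less_eq mult.commute intro!: imageI)
  qed
  then have "card {m\<in>{1..t}. d dvd m} \<le> card {1..t div d}"
    by (meson card_image_le card_mono finite_atLeastAtMost finite_imageI le_trans)
  then have "real (card {m\<in>{1..t}. d dvd m}) \<le> real (t div d)"
    by simp
  also have "\<dots> \<le> real t / real d"
    by (rule of_nat_div_le_of_nat)
  finally show ?thesis .
qed

text \<open>Union bound: a pair that is not coprime has both entries divisible by its gcd d with 2
  \<le> d \<le> t, and each d accounts for at most (t/d)^2 pairs. Together these are at most three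
  quarters of all pairs.\<close>

lemma card_coprime_pairs_ge:
  "real t ^ 2 / 4 \<le> real (card {(m, n) \<in> {1..t} \<times> {1..t}. coprime m n})"
proof -
  let ?P = "{(m, n) \<in> {1..t} \<times> {1..t}. coprime m n}"
  let ?M = "\<lambda>d. {m\<in>{1..t}. d dvd m}"
  have finP: "finite ?P"
    by (rule finite_subset[of _ "{1..t} \<times> {1..t}"]) auto
  have "{1..t} \<times> {1..t} \<subseteq> ?P \<union> (\<Union>d\<in>{2..t}. ?M d \<times> ?M d)"
  proof (rule subsetI, rule UnCI)
    fix x
    assume x: "x \<in> {1..t} \<times> {1..t}" "x \<notin> (\<Union>d\<in>{2..t}. ?M d \<times> ?M d)"
    then obtain m n where mn: "x = (m, n)" "m \<in> {1..t}" "n \<in> {1..t}"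
      by blast
    have "coprime m n"
    proof (rule ccontr)
      assume "\<not> coprime m n"
      then have "gcd m n \<noteq> 1"
        by (metis coprime_iff_gcd_eq_1)
      moreover have "gcd m n \<noteq> 0" "gcd m n \<le> t"
        using mn(2) order.trans[OF gcd_le1_nat[of m n], of t] by auto
      ultimately have "gcd m n \<in> {2..t}"
        unfolding atLeastAtMost_iff by linarith
      moreover have "x \<in> ?M (gcd m n) \<times> ?M (gcd m n)"
        using mn by simp
      ultimately show False
        using x(2) by blast
    qed
    with mn show "x \<in> ?P"
      by simp
  qed
  then have "card ({1..t} \<times> {1..t}) \<le> card (?P \<union> (\<Union>d\<in>{2..t}. ?M d \<times> ?M d))"
    using finP by (intro card_mono) auto
  also have "\<dots> \<le> card ?P + (\<Sum>d=2..t. card (?M d \<times> ?M d))"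
    by (rule order.trans[OF card_Un_le add_left_mono[OF card_UN_le]]) simp
  finally have "t ^ 2 \<le> card ?P + (\<Sum>d=2..t. (card (?M d))\<^sup>2)"
    by (simp add: card_cartesian_product power2_eq_square)
  then have "real t ^ 2 \<le> real (card ?P) + (\<Sum>d=2..t. (real (card (?M d)))\<^sup>2)"
    by (simp flip: of_nat_power of_nat_sum of_nat_add)
  also have "(\<Sum>d=2..t. (real (card (?M d)))\<^sup>2) \<le> (\<Sum>d=2..t. (real t / real d)\<^sup>2)"
    by (intro sum_mono power_mono card_multiples_le) auto
  also have "\<dots> = real t ^ 2 * (\<Sum>d=2..t. 1 / (real d)\<^sup>2)"
    by (simp add: sum_distrib_left power_divide)
  also have "\<dots> \<le> real t ^ 2 * (3 / 4)"
    by (intro mult_left_mono sum_inverse_squares_le) simp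
  finally show ?thesis by simp
qed

text \<open>Uniqueness of lowest terms: coprimality turns the equation into divisibility in both
  directions, for numerators and for denominators.\<close>

lemma coprime_cross_mult_eq:
  fixes m n m' n' :: nat
  assumes "coprime m n" "coprime m' n'" "m * n' = m' * n"
  shows "m = m' \<and> n = n'"
proof -
  have "m dvd m'" "m' dvd m" "n dvd n'" "n' dvd n"
    using assms
    by (metis coprime_commute coprime_dvd_mult_left_iff coprime_dvd_mult_right_iff dvd_triv_left
        dvd_triv_right)+
  then show ?thesis
    by (simp add: dvd_antisym)
qed

text \<open>\<open>Q\<close> consists of the residues m / n with m and n coprime and at most
  \<open>t\<close>. The size of \<open>t\<close> makes these residues distinct and different from 0
  and -1.\<close>

lemma ratio_set_exists:
  assumes p: "prime p" and p2: "p > 2" and t: "t * t < p"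
  obtains Q where "Q \<subseteq> {1..<int p - 1}" "real t ^ 2 / 4 \<le> real (card Q)"
    "\<And>q. q \<in> Q \<Longrightarrow> \<exists>m\<in>{1..t}. \<exists>n\<in>{1..t}. [int n * q = int m] (mod int p)"
proof -
  let ?P = "{(m, n) \<in> {1..t} \<times> {1..t}. coprime m n}"
  \<comment> \<open>This keeps m + n below \<open>p\<close>. For t = 1 it rests on
    \<open>p > 2\<close>, since 1 = -1 modulo 2.\<close>
  have tp: "2 * t < p"
  proof (cases "t \<ge> 2")
    case True
    then have "2 * t \<le> t * t" by (rule mult_le_mono1)
    then show ?thesis using t by (rule le_less_trans)
  next
    case False
    then have "t = 0 \<or> t = 1" by auto
    with p2 show ?thesis by auto
  qed
  have ex: "\<exists>q. 0 \<le> q \<and> q < int p \<and> [int n * q = int m] (mod int p)" if "n \<in> {1..t}" for m n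
  proof -
    have "\<not> p dvd n"
      using that tp by (auto dest: dvd_imp_le)
    then have "coprime (int n) (int p)"
      using p by (metis coprime_commute coprime_int_iff prime_imp_coprime)
    then obtain x where "[int n * x = 1] (mod int p)"
      using cong_solve_coprime_int by blast
    then have "[int n * x * int m = 1 * int m] (mod int p)"
      by (rule cong_scalar_right)
    then have "[int n * (x * int m mod int p) = int m] (mod int p)"
      by (simp add: cong_def mod_mult_right_eq mult.assoc)
    then show ?thesis
      using p2 by (intro exI[of _ "x * int m mod int p"]) auto
  qed
  \<comment> \<open>The reduced representative of m / n, specified only for \<open>n\<close> in
    \<open>{1..t}\<close>, where \<open>n\<close> is invertible.\<close>
  define r where "r m n = (SOME q. 0 \<le> q \<and> q < int p \<and> [int n * q = int m] (mod int p))"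
    for m n :: nat
  have r: "0 \<le> r m n \<and> r m n < int p \<and> [int n * r m n = int m] (mod int p)"
    if "n \<in> {1..t}" for m n
    unfolding r_def by (rule someI_ex) (rule ex[OF that])
  let ?Q = "(\<lambda>(m, n). r m n) ` ?P"
  have "inj_on (\<lambda>(m, n). r m n) ?P"
  proof (intro inj_onI; clarify)
    fix m n m' n'
    assume mn: "m \<in> {1..t}" "n \<in> {1..t}" "coprime m n" "m' \<in> {1..t}" "n' \<in> {1..t}" "coprime m' n'"
      and eq: "r m n = r m' n'"
    have "[int n' * int m = int n' * (int n * r m n)] (mod int p)"
      using r[OF mn(2), of m] by (intro cong_scalar_left) (simp add: cong_sym)
    also have "int n' * (int n * r m n) = int n * (int n' * r m' n')"
      by (simp add: eq)
    also have "[\<dots> = int n * int m'] (mod int p)"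
      using r[OF mn(5), of m'] by (intro cong_scalar_left) simp
    finally have "[n' * m = n * m'] (mod p)"
      by (metis cong_int_iff of_nat_mult)
    \<comment> \<open>Both cross products are at most \<open>t * t < p\<close>, so their congruence
      is an equality of integers.\<close>
    moreover have "n' * m \<le> t * t" "n * m' \<le> t * t"
      using mn by (auto intro: mult_le_mono)
    ultimately have "m * n' = m' * n"
      using t by (simp add: cong_def mult.commute)
    then show "m = m' \<and> n = n'"
      using coprime_cross_mult_eq mn(3,6) by blast
  qed
  then have "card ?Q = card ?P"
    by (rule card_image)
  then have "real t ^ 2 / 4 \<le> real (card ?Q)"
    using card_coprime_pairs_ge[of t] by simp
  moreover have "?Q \<subseteq> {1..<int p - 1}"
  proof clarify
    fix m n assume mn: "m \<in> {1..t}" "n \<in> {1..t}"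
    have *: "int p dvd int n * r m n - int m"
      using r[OF mn(2), of m] by (simp add: cong_iff_dvd_diff)
    have "r m n \<noteq> 0"
    proof
      assume "r m n = 0"
      with * have "p dvd m" by simp
      with mn tp show False by (auto dest: dvd_imp_le)
    qed
    moreover have "r m n \<noteq> int p - 1"
    proof
      assume eq: "r m n = int p - 1"
      \<comment> \<open>If m / n were -1, then \<open>p\<close> would divide m + n, which is
        positive and at most \<open>2 * t\<close>.\<close>
      have "int p dvd int n * int p - (int n * r m n - int m)"
        by (rule dvd_diff[OF dvd_triv_right *])
      also have "int n * int p - (int n * r m n - int m) = int (n + m)"
        by (simp add: eq algebra_simps)
      finally have "p dvd n + m" by (simp only: int_dvd_int_iff)
      with mn tp show False by (auto dest: dvd_imp_le)
    qed
    ultimately show "r m n \<in> {1..<int p - 1}"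
      using r[OF mn(2), of m] by auto
  qed
  moreover have "\<exists>m\<in>{1..t}. \<exists>n\<in>{1..t}. [int n * q = int m] (mod int p)" if "q \<in> ?Q" for q
    using that r by fast
  ultimately show ?thesis
    using that by blast
qed

section \<open>The bound for non-averaging sets\<close>

lemma non_averaging_card_pow3_le:
  assumes p: "prime p" and p2: "p > 2" and t: "t * t < p" and A: "non_averaging p t A"
    and large: "2 * p \<le> (card A)\<^sup>2"
  shows "real t ^ 2 * real (card A) ^ 3 \<le> 16 * real p ^ 3"
proof -
  obtain Q where Q: "Q \<subseteq> {1..<int p - 1}" "real t ^ 2 / 4 \<le> real (card Q)"
    "\<And>q. q \<in> Q \<Longrightarrow> \<exists>m\<in>{1..t}. \<exists>n\<in>{1..t}. [int n * q = int m] (mod int p)"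
    using ratio_set_exists[OF p p2 t] by blast
  have "x1 = x2 \<and> x2 = x3"
    if q: "q \<in> Q" and x: "x1 \<in> A" "x2 \<in> A" "x3 \<in> A"
      and eq: "[q * x1 + x2 = (q + 1) * x3] (mod int p)" for q x1 x2 x3
  proof -
    obtain m n where mn: "m \<in> {1..t}" "n \<in> {1..t}" "[int n * q = int m] (mod int p)"
      using Q(3)[OF q] by blast
    \<comment> \<open>Multiplying by \<open>n\<close> clears the denominator of q = m / n and yields
      an equation covered by the definition of non-averaging.\<close>
    have "[int m * x1 + int n * x2 = int n * q * x1 + int n * x2] (mod int p)"
      using mn(3) by (intro cong_add cong_scalar_right) (auto simp: cong_sym)
    also have "int n * q * x1 + int n * x2 = int n * (q * x1 + x2)"
      by (simp add: algebra_simps)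
    also have "[\<dots> = int n * ((q + 1) * x3)] (mod int p)"
      using eq by (rule cong_scalar_left)
    also have "int n * ((q + 1) * x3) = (int n * q + int n) * x3"
      by (simp add: algebra_simps)
    also have "[\<dots> = (int m + int n) * x3] (mod int p)"
      using mn(3) by (intro cong_add cong_scalar_right) auto
    finally show ?thesis
      using A mn(1,2) x unfolding non_averaging_def
      by (metis atLeastAtMost_iff of_nat_1 of_nat_le_iff)
  qed
  moreover have "A \<subseteq> {0..<int p}"
    using A by (auto simp: non_averaging_def residue_ring_def)
  ultimately have "real (card Q) * real (card A) ^ 3 \<le> 4 * real p ^ 3"
    using Q(1) p large by (intro card_pow3_le_of_trivial_solutions) blast+
  \<comment> \<open>The factor 1/4 turns the constant 4 into 16.\<close>
  moreover have "real t ^ 2 / 4 * real (card A) ^ 3 \<le> real (card Q) * real (card A) ^ 3"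
    using Q(2) by (intro mult_right_mono) auto
  ultimately show ?thesis by simp
qed

theorem theorem34:
  shows "\<exists>C::real. C > 0 \<and>
    (\<forall>(p::nat) (t::nat) (A::int set).
       prime p \<longrightarrow> t > 0 \<longrightarrow> real t < sqrt (real p) \<longrightarrow> non_averaging p t A \<longrightarrow>
       real (card A) \<le> C * (real p / real t powr (2 / 3)))"
proof (intro exI[of _ 3] conjI allI impI)
  fix p t :: nat and A :: "int set"
  assume p: "prime p" and t0: "t > 0" and t: "real t < sqrt (real p)" and A: "non_averaging p t A"
  define s where "s = real t powr (2 / 3)"
  have s0: "s > 0" and s3: "s ^ 3 = real t ^ 2"
    using t0 by (auto simp: s_def powr_power powr_numeral)
  have "(real t)\<^sup>2 < real p"
    using t by (metis of_nat_0_le_iff real_sqrt_less_iff real_sqrt_abs abs_of_nat)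
  then have tt: "t * t < p"
    by (metis of_nat_less_iff of_nat_mult power2_eq_square)
  have sub: "A \<subseteq> {0..<int p}"
    using A by (auto simp: non_averaging_def residue_ring_def)
  \<comment> \<open>Comparing cubes replaces the fractional power by
    \<open>s ^ 3 = real t ^ 2\<close>. The constant 27 covers 16 from the main case and 2 from the
    remaining one.\<close>
  have "(real (card A) * s) ^ 3 \<le> (3 * real p) ^ 3"
  proof (cases "p > 2 \<and> 2 * p \<le> (card A)\<^sup>2")
    case True
    then have "real t ^ 2 * real (card A) ^ 3 \<le> 16 * real p ^ 3"
      using non_averaging_card_pow3_le[OF p _ tt A] by blast
    also have "\<dots> \<le> 27 * real p ^ 3"
      by simp
    finally show ?thesis
      by (simp add: power_mult_distrib s3 mult.commute)
  next
    case False
    \<comment> \<open>Either \<open>A\<close> is too small for the main estimate, or p = 2 and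
      \<open>A\<close> has at most 2 elements. With t^2 < p this gives t^2 |A|^3 \<le> 2 p^3
      directly.\<close>
    have "real (card A) ^ 2 \<le> 2 * real p"
    proof (cases "p > 2")
      case True
      with False have "(card A)\<^sup>2 \<le> 2 * p" by simp
      then show ?thesis
        by (metis of_nat_le_iff of_nat_mult of_nat_numeral of_nat_power)
    next
      case False
      with prime_ge_2_nat[OF p] have "p = 2"
        by simp
      moreover have "card A \<le> p"
        using card_mono[OF _ sub] by simp
      ultimately show ?thesis
        using power_mono[of "real (card A)" 2 2] by simp
    qed
    moreover have "real (card A) \<le> real p"
      using card_mono[OF _ sub] by simp
    ultimately have "real (card A) * real (card A) ^ 2 \<le> real p * (2 * real p)"
      by (intro mult_mono) auto
    moreover have "s ^ 3 \<le> real p"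
      using \<open>(real t)\<^sup>2 < real p\<close> s3 by simp
    ultimately have "real (card A) ^ 3 * s ^ 3 \<le> real p * (2 * real p) * real p"
      using s0 by (intro mult_mono) (auto simp: power3_eq_cube power2_eq_square)
    also have "\<dots> \<le> 27 * real p ^ 3"
      by (simp add: power3_eq_cube)
    finally show ?thesis
      by (simp add: power_mult_distrib)
  qed
  then have "real (card A) * s \<le> 3 * real p"
    using power_mono_iff[of "real (card A) * s" "3 * real p" 3] s0 by simp
  then show "real (card A) \<le> 3 * (real p / real t powr (2 / 3))"
    using s0 by (simp add: s_def field_simps)
qed simp

end
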